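(* Let $\eta\neq 0$ be a real constant, let $U\subset\mathbf{R}^2$ be open with coordinates $(\tau,\mu)$, and let $R,\zeta,\kappa:U\to\mathbf{R}$ be smooth functions satisfying $$\eta^2\,\partial_\tau^2 R=R\,\partial_\mu(R\,\partial_\mu R),$$ $$\partial_\tau\zeta=\tfrac12\Big((\partial_\tau R)^2+\frac{R^2(\partial_\mu R)^2}{\eta^2}\Big),\qquad \partial_\mu\zeta=\partial_\tau R\,\partial_\mu R,$$ $$\partial_\mu\kappa=\eta\,\partial_\tau\zeta,\qquad \partial_\tau\kappa=\frac{R^2}{\eta}\,\partial_\mu\zeta .$$ Assume that $(\tau,\mu)\mapsto(\zeta(\tau,\mu),\kappa(\tau,\mu))$ is an invertible change of variables (a diffeomorphism from $U$ onto its open image $V$), and define $\rho:V\to\mathbf{R}$ by expressing $R$ in terms of $\zeta,\kappa$, i.e. $\rho(\zeta(\tau,\mu),\kappa(\tau,\mu))=R(\tau,\mu)$. Then $\rho$ satisfies $$\partial_\zeta^2\rho=\rho\,\partial_\kappa(\rho\,\partial_\kappa\rho)$$ on $V$.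
   Context: All functions are real-valued and smooth. $\partial_\zeta,\partial_\kappa$ denote partial derivatives with respect to the first and second argument of functions on $V$. *)

theory Defs
  imports "HOL-Analysis.Analysis"
begin

definition partial1 :: "(real \<times> real \<Rightarrow> real) \<Rightarrow> real \<times> real \<Rightarrow> real" where
  "partial1 f p = deriv (\<lambda>t. f (t, snd p)) (fst p)"

definition partial2 :: "(real \<times> real \<Rightarrow> real) \<Rightarrow> real \<times> real \<Rightarrow> real" where
  "partial2 f p = deriv (\<lambda>t. f (fst p, t)) (snd p)"

text \<open>
  Meant for open \<open>U\<close> only, where it is the usual class of k times continuously differentiable
  functions. The values of \<open>f\<close> outside \<open>U\<close> are then irrelevant. Frechet differentiability makes
  the sections of \<open>f\<close> differentiable, so that \<open>deriv\<close> is meaningful in the two partial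
  derivatives.
\<close>
primrec Ck_on :: "nat \<Rightarrow> (real \<times> real) set \<Rightarrow> (real \<times> real \<Rightarrow> real) \<Rightarrow> bool" where
  "Ck_on 0 U f \<longleftrightarrow> continuous_on U f"
| "Ck_on (Suc k) U f \<longleftrightarrow>
     f differentiable_on U \<and> Ck_on k U (partial1 f) \<and> Ck_on k U (partial2 f)"

definition smooth_on :: "(real \<times> real) set \<Rightarrow> (real \<times> real \<Rightarrow> real) \<Rightarrow> bool" where
  "smooth_on U f \<longleftrightarrow> (\<forall>k. Ck_on k U f)"

definition smooth_map_on :: "(real \<times> real) set \<Rightarrow> (real \<times> real \<Rightarrow> real \<times> real) \<Rightarrow> bool" where
  "smooth_map_on U \<Phi> \<longleftrightarrow> smooth_on U (\<lambda>p. fst (\<Phi> p)) \<and> smooth_on U (\<lambda>p. snd (\<Phi> p))"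

definition diffeomorphism_on ::
    "(real \<times> real) set \<Rightarrow> (real \<times> real) set \<Rightarrow> (real \<times> real \<Rightarrow> real \<times> real) \<Rightarrow> bool" where
  "diffeomorphism_on U V \<Phi> \<longleftrightarrow>
     open U \<and> open V \<and> bij_betw \<Phi> U V \<and> smooth_map_on U \<Phi> \<and> smooth_map_on V (inv_into U \<Phi>)"

end

theory Submission imports Defs begin

text \<open>
  Why the theorem is true. Write \<open>a = \<partial>\<^sub>\<tau> R\<close> and \<open>c = R \<partial>\<^sub>\<mu> R / \<eta>\<close>, so that the equation for \<open>R\<close>
  reads \<open>\<partial>\<^sub>\<tau> a = (R / \<eta>) \<partial>\<^sub>\<mu> c\<close>. It is a wave equation whose characteristic directions are
  \<open>\<partial>\<^sub>\<tau> \<plusminus> (R / \<eta>) \<partial>\<^sub>\<mu>\<close>; those of the equation for \<open>\<rho>\<close> are \<open>\<partial>\<^sub>\<zeta> \<plusminus> \<rho> \<partial>\<^sub>\<kappa>\<close>. The four equations for \<open>\<zeta>\<close>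
  and \<open>\<kappa>\<close> say exactly that the change of variables \<open>\<Phi> = (\<zeta>, \<kappa>)\<close> sends the former to multiples of the latter:
  for every differentiable \<open>f\<close> on \<open>V\<close>,
  \<open>(\<partial>\<^sub>\<tau> \<plusminus> (R / \<eta>) \<partial>\<^sub>\<mu>) (f \<circ> \<Phi>) = ((a \<plusminus> c)\<^sup>2 / 2) \<cdot> ((\<partial>\<^sub>\<zeta> \<plusminus> \<rho> \<partial>\<^sub>\<kappa>) f \<circ> \<Phi>)\<close>
  (lemma \<open>characteristic_transport\<close>).

  Taking for \<open>f\<close> the first component of \<open>\<Phi>\<^sup>-\<^sup>1\<close>, the left side is 1, hence \<open>a \<plusminus> c \<noteq> 0\<close>.
  Taking \<open>f = \<rho>\<close>, the left side is \<open>a \<plusminus> c\<close>, hence \<open>\<partial>\<^sub>\<zeta> \<rho> \<plusminus> \<rho> \<partial>\<^sub>\<kappa> \<rho> = 2 / (a \<plusminus> c)\<close>.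
  Finally put \<open>P = \<partial>\<^sub>\<zeta> \<rho>\<close> and \<open>Q = \<rho> \<partial>\<^sub>\<kappa> \<rho>\<close>, differentiate \<open>P + Q\<close> along the
  minus direction and \<open>P - Q\<close> along the plus direction, and add. The terms \<open>\<rho> \<partial>\<^sub>\<kappa> P\<close> and \<open>\<partial>\<^sub>\<zeta> Q\<close>
  cancel, which leaves \<open>2 (\<partial>\<^sub>\<zeta> P - \<rho> \<partial>\<^sub>\<kappa> Q)\<close>. Computed on \<open>U\<close> from \<open>2 / (a \<plusminus> c)\<close>, the same sum is
  a multiple of \<open>\<partial>\<^sub>\<tau> a - (R / \<eta>) \<partial>\<^sub>\<mu> c\<close>, which vanishes.

  That \<open>\<rho> = R \<circ> \<Phi>\<^sup>-\<^sup>1\<close> is smooth is the chain rule, iterated (lemma \<open>Ck_on_compose\<close>).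
\<close>

section \<open>Partial derivatives and the Frechet derivative\<close>

lemma has_derivative_imp_partials:
  assumes "(f has_derivative D) (at p)"
  shows "partial1 f p = D (1, 0)" and "partial2 f p = D (0, 1)"
proof -
  interpret bounded_linear D
    using assms by (rule has_derivative_bounded_linear)
  have "((\<lambda>t. (t, snd p)) has_derivative (\<lambda>h. (h, 0))) (at (fst p))"
    by (auto intro!: derivative_eq_intros)
  from has_derivative_compose[OF this, of f D]
  have "((\<lambda>t. f (t, snd p)) has_derivative (\<lambda>h. D (h, 0))) (at (fst p))"
    using assms by simp
  moreover have "(\<lambda>h. D (h, 0)) = (*) (D (1, 0))"
  proof
    show "D (h, 0) = D (1, 0) * h" for h
      using scaleR[of h "(1, 0)"] by simp
  qed
  ultimately have "((\<lambda>t. f (t, snd p)) has_field_derivative D (1, 0)) (at (fst p))"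
    by (simp add: has_field_derivative_def)
  then show "partial1 f p = D (1, 0)"
    unfolding partial1_def by (rule DERIV_imp_deriv)
  have "((\<lambda>t. (fst p, t)) has_derivative (\<lambda>h. (0, h))) (at (snd p))"
    by (auto intro!: derivative_eq_intros)
  from has_derivative_compose[OF this, of f D]
  have "((\<lambda>t. f (fst p, t)) has_derivative (\<lambda>h. D (0, h))) (at (snd p))"
    using assms by simp
  moreover have "(\<lambda>h. D (0, h)) = (*) (D (0, 1))"
  proof
    show "D (0, h) = D (0, 1) * h" for h
      using scaleR[of h "(0, 1)"] by simp
  qed
  ultimately have "((\<lambda>t. f (fst p, t)) has_field_derivative D (0, 1)) (at (snd p))"
    by (simp add: has_field_derivative_def)
  then show "partial2 f p = D (0, 1)"
    unfolding partial2_def by (rule DERIV_imp_deriv)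
qed

lemma differentiable_imp_has_derivative_partials:
  assumes "f differentiable (at p)"
  shows "(f has_derivative (\<lambda>h. partial1 f p * fst h + partial2 f p * snd h)) (at p)"
proof -
  from assms obtain D where D: "(f has_derivative D) (at p)"
    by (auto simp: differentiable_def)
  interpret bounded_linear D
    using D by (rule has_derivative_bounded_linear)
  have "D h = partial1 f p * fst h + partial2 f p * snd h" for h
  proof -
    have "D h = D (fst h *\<^sub>R (1, 0) + snd h *\<^sub>R (0, 1))"
      by (cases h) simp
    also have "\<dots> = fst h *\<^sub>R D (1, 0) + snd h *\<^sub>R D (0, 1)"
      by (simp only: add scaleR)
    finally show ?thesis
      using has_derivative_imp_partials[OF D] by (simp add: mult.commute)
  qed
  then have "D = (\<lambda>h. partial1 f p * fst h + partial2 f p * snd h)"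
    by auto
  with D show ?thesis by simp
qed

lemma partials_transform:
  assumes "f differentiable (at p)" and "open U" and "p \<in> U" and "\<And>q. q \<in> U \<Longrightarrow> f q = g q"
  shows "partial1 g p = partial1 f p" and "partial2 g p = partial2 f p"
proof -
  have "(g has_derivative (\<lambda>h. partial1 f p * fst h + partial2 f p * snd h)) (at p)"
    using differentiable_imp_has_derivative_partials[OF assms(1)] assms(2-4)
    by (rule has_derivative_transform_within_open)
  from has_derivative_imp_partials[OF this]
  show "partial1 g p = partial1 f p" and "partial2 g p = partial2 f p" by simp_all
qed

lemma partials_add:
  assumes "f differentiable (at p)" and "g differentiable (at p)"
  shows "partial1 (\<lambda>q. f q + g q) p = partial1 f p + partial1 g p"
    and "partial2 (\<lambda>q. f q + g q) p = partial2 f p + partial2 g p"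
  using has_derivative_imp_partials[OF has_derivative_add
      [OF assms[THEN differentiable_imp_has_derivative_partials]]]
  by simp_all

lemma partials_mult:
  assumes "f differentiable (at p)" and "g differentiable (at p)"
  shows "partial1 (\<lambda>q. f q * g q) p = partial1 f p * g p + f p * partial1 g p"
    and "partial2 (\<lambda>q. f q * g q) p = partial2 f p * g p + f p * partial2 g p"
  using has_derivative_imp_partials[OF has_derivative_mult
      [OF assms[THEN differentiable_imp_has_derivative_partials]]]
  by simp_all

lemma partials_cmult:
  fixes k :: real
  assumes "f differentiable (at p)"
  shows "partial1 (\<lambda>q. k * f q) p = k * partial1 f p"
    and "partial2 (\<lambda>q. k * f q) p = k * partial2 f p"
  using has_derivative_imp_partials[OF has_derivative_mult_right
      [OF differentiable_imp_has_derivative_partials[OF assms]]]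
  by simp_all

lemma partials_compose:
  assumes "f differentiable (at (x p, y p))" and "x differentiable (at p)" and "y differentiable (at p)"
  shows "partial1 (\<lambda>q. f (x q, y q)) p =
           partial1 f (x p, y p) * partial1 x p + partial2 f (x p, y p) * partial1 y p"
    and "partial2 (\<lambda>q. f (x q, y q)) p =
           partial1 f (x p, y p) * partial2 x p + partial2 f (x p, y p) * partial2 y p"
  using has_derivative_imp_partials[OF has_derivative_compose
      [OF has_derivative_Pair[OF assms(2,3)[THEN differentiable_imp_has_derivative_partials]]
        differentiable_imp_has_derivative_partials[OF assms(1)]]]
  by simp_all

lemma differentiable_compose_Pair:
  fixes f x y :: "real \<times> real \<Rightarrow> real"
  assumes "f differentiable (at (x p, y p))" and "x differentiable (at p)" and "y differentiable (at p)"
  shows "(\<lambda>q. f (x q, y q)) differentiable (at p)"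
  using has_derivative_compose
      [OF has_derivative_Pair[OF assms(2,3)[THEN differentiable_imp_has_derivative_partials]]
        differentiable_imp_has_derivative_partials[OF assms(1)]]
  by (auto simp: differentiable_def)

section \<open>Smooth functions are closed under composition\<close>

lemma differentiable_on_openD:
  "f differentiable_on U \<Longrightarrow> open U \<Longrightarrow> p \<in> U \<Longrightarrow> f differentiable (at p)"
  by (simp add: differentiable_on_eq_differentiable_at)

lemma Ck_on_SucD:
  "Ck_on (Suc k) U f \<Longrightarrow> Ck_on k U f"
proof (induction k arbitrary: f)
  case 0
  then show ?case by (simp add: differentiable_imp_continuous_on)
next
  case (Suc k)
  then show ?case by (metis Ck_on.simps(2))
qed

lemma Ck_on_cong:
  assumes "open U" and "Ck_on k U f" and "\<And>p. p \<in> U \<Longrightarrow> f p = g p"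
  shows "Ck_on k U g"
  using assms(2,3)
proof (induction k arbitrary: f g)
  case 0
  then show ?case by (metis Ck_on.simps(1) continuous_on_eq)
next
  case (Suc k)
  then have d: "f differentiable (at p)" if "p \<in> U" for p
    using that assms(1) differentiable_on_openD by auto
  have "g differentiable_on U"
    unfolding differentiable_on_def
  proof
    fix p assume p: "p \<in> U"
    then have "f differentiable (at p within U)"
      using d differentiable_at_withinI by blast
    then show "g differentiable (at p within U)"
      using p by (rule differentiable_transform_within[OF _ zero_less_one]) (auto simp: Suc.prems(2))
  qed
  then show ?case
    using Suc.IH[of "partial1 f" "partial1 g"] Suc.IH[of "partial2 f" "partial2 g"] Suc.prems
      partials_transform[OF d assms(1) _ Suc.prems(2)]
    by simp
qed

lemma Ck_on_add:
  assumes "open U" and "Ck_on k U f" and "Ck_on k U g"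
  shows "Ck_on k U (\<lambda>p. f p + g p)"
  using assms(2,3)
proof (induction k arbitrary: f g)
  case 0
  then show ?case by (simp add: continuous_on_add)
next
  case (Suc k)
  then have d: "f differentiable (at p)" "g differentiable (at p)" if "p \<in> U" for p
    using that assms(1) differentiable_on_openD by auto
  have "Ck_on k U (\<lambda>p. partial1 f p + partial1 g p)" "Ck_on k U (\<lambda>p. partial2 f p + partial2 g p)"
    using Suc by auto
  then have "Ck_on k U (partial1 (\<lambda>p. f p + g p))" "Ck_on k U (partial2 (\<lambda>p. f p + g p))"
    by - (erule Ck_on_cong[OF assms(1)], simp add: partials_add d)+
  with Suc.prems show ?case by (simp add: differentiable_on_add)
qed

lemma Ck_on_mult:
  assumes "open U" and "Ck_on k U f" and "Ck_on k U g"
  shows "Ck_on k U (\<lambda>p. f p * g p)"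
  using assms(2,3)
proof (induction k arbitrary: f g)
  case 0
  then show ?case by (simp add: continuous_on_mult)
next
  case (Suc k)
  then have d: "f differentiable (at p)" "g differentiable (at p)" if "p \<in> U" for p
    using that assms(1) differentiable_on_openD by auto
  have "Ck_on k U f" "Ck_on k U g"
    using Suc.prems by (auto intro: Ck_on_SucD simp del: Ck_on.simps)
  then have "Ck_on k U (\<lambda>p. partial1 f p * g p + f p * partial1 g p)"
      "Ck_on k U (\<lambda>p. partial2 f p * g p + f p * partial2 g p)"
    using Suc by (auto intro!: Ck_on_add[OF assms(1)])
  then have "Ck_on k U (partial1 (\<lambda>p. f p * g p))" "Ck_on k U (partial2 (\<lambda>p. f p * g p))"
    by - (erule Ck_on_cong[OF assms(1)], simp add: partials_mult d)+
  with Suc.prems show ?case by (simp add: differentiable_on_mult)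
qed

text \<open>
  The chain rule expresses each partial derivative of the composite through composites of partial
  derivatives of \<open>f\<close>, which have one derivative less; hence the induction is over all \<open>f\<close>, with the
  inner functions \<open>x\<close> and \<open>y\<close> fixed.
\<close>
lemma Ck_on_compose:
  assumes "open U" and "open V" and "Ck_on k U f" and "Ck_on k V x" and "Ck_on k V y"
    and "\<And>v. v \<in> V \<Longrightarrow> (x v, y v) \<in> U"
  shows "Ck_on k V (\<lambda>v. f (x v, y v))"
  using assms(3-5)
proof (induction k arbitrary: f)
  case 0
  then show ?case
    using assms(6) by (auto intro!: continuous_on_compose2[of U f] continuous_on_Pair)
next
  case (Suc k)
  then have d: "f differentiable (at (x v, y v))" "x differentiable (at v)" "y differentiable (at v)"
    if "v \<in> V" for v
    using that assms(6)[OF that]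
    by (auto intro: differentiable_on_openD[OF _ assms(1)] differentiable_on_openD[OF _ assms(2)])
  have xy: "Ck_on k V x" "Ck_on k V y"
    using Suc.prems by (auto intro: Ck_on_SucD simp del: Ck_on.simps)
  have "Ck_on k V (\<lambda>v. partial1 f (x v, y v) * partial1 x v + partial2 f (x v, y v) * partial1 y v)"
    "Ck_on k V (\<lambda>v. partial1 f (x v, y v) * partial2 x v + partial2 f (x v, y v) * partial2 y v)"
    using Suc xy by (auto intro!: Ck_on_add[OF assms(2)] Ck_on_mult[OF assms(2)])
  then have "Ck_on k V (partial1 (\<lambda>v. f (x v, y v)))" "Ck_on k V (partial2 (\<lambda>v. f (x v, y v)))"
    by - (erule Ck_on_cong[OF assms(2)], simp add: partials_compose d)+
  moreover have "(\<lambda>v. f (x v, y v)) differentiable_on V"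
    using assms(2) d by (auto simp: differentiable_on_eq_differentiable_at intro: differentiable_compose_Pair)
  ultimately show ?case by simp
qed

lemma smooth_on_partials:
  assumes "smooth_on U f"
  shows "smooth_on U (partial1 f)" and "smooth_on U (partial2 f)"
  using assms unfolding smooth_on_def by (metis Ck_on.simps(2))+

lemma smooth_on_mult:
  "open U \<Longrightarrow> smooth_on U f \<Longrightarrow> smooth_on U g \<Longrightarrow> smooth_on U (\<lambda>p. f p * g p)"
  by (simp add: smooth_on_def Ck_on_mult)

lemma smooth_on_imp_differentiable:
  "smooth_on U f \<Longrightarrow> open U \<Longrightarrow> p \<in> U \<Longrightarrow> f differentiable (at p)"
  unfolding smooth_on_def by (metis Ck_on.simps(2) differentiable_on_openD)

section \<open>Derivatives along characteristic directions\<close>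

definition slope_deriv :: "real \<Rightarrow> (real \<times> real \<Rightarrow> real) \<Rightarrow> real \<times> real \<Rightarrow> real" where
  "slope_deriv l f p = partial1 f p + l * partial2 f p"

lemma slope_deriv_add_cmult:
  assumes "f differentiable (at p)" and "g differentiable (at p)"
  shows "slope_deriv l (\<lambda>q. f q + k * g q) p = slope_deriv l f p + k * slope_deriv l g p"
  using assms
  by (simp add: slope_deriv_def partials_add partials_cmult differentiable_mult algebra_simps)

lemma slope_deriv_mult_constant:
  assumes "f differentiable (at p)" and "g differentiable (at p)" and "open U" and "p \<in> U"
    and "\<And>q. q \<in> U \<Longrightarrow> f q * g q = k"
  shows "slope_deriv l f p * g p + f p * slope_deriv l g p = 0"
proof -
  have "((\<lambda>q. k) has_derivative (\<lambda>h. 0)) (at p)" by simp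
  from has_derivative_imp_partials[OF this]
  have "slope_deriv l (\<lambda>q. k) p = 0" by (simp add: slope_deriv_def)
  moreover have "slope_deriv l (\<lambda>q. k) p = slope_deriv l (\<lambda>q. f q * g q) p"
    using partials_transform[of "\<lambda>q. f q * g q" p U "\<lambda>q. k"] assms
    by (simp add: slope_deriv_def differentiable_mult)
  ultimately show ?thesis
    using assms(1,2) by (simp add: slope_deriv_def partials_mult algebra_simps)
qed

text \<open>
  Here \<open>r\<close>, \<open>a\<close>, \<open>b\<close> stand for the values of \<open>R\<close>, \<open>\<partial>\<^sub>\<tau> R\<close>, \<open>\<partial>\<^sub>\<mu> R\<close> at the point \<open>p\<close>, and the sign
  \<open>s\<close> selects one of the two families of characteristics. The chain rule gives
  \<open>f\<^sub>\<zeta> (\<zeta>\<^sub>\<tau> + s (r / \<eta>) \<zeta>\<^sub>\<mu>) + f\<^sub>\<kappa> (\<kappa>\<^sub>\<tau> + s (r / \<eta>) \<kappa>\<^sub>\<mu>)\<close>; by the relations between \<open>\<zeta>\<close> and \<open>\<kappa>\<close>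
  the second bracket is \<open>s r\<close> times the first. The first is half of a perfect square because
  \<open>\<partial>\<^sub>\<tau> \<zeta> = (a\<^sup>2 + c\<^sup>2) / 2\<close> and \<open>(r / \<eta>) \<partial>\<^sub>\<mu> \<zeta> = a c\<close> for \<open>c = r b / \<eta>\<close>.
\<close>
lemma characteristic_transport:
  assumes "\<eta> \<noteq> 0" and s: "s\<^sup>2 = 1"
    and "f differentiable (at (\<zeta> p, \<kappa> p))" and "\<zeta> differentiable (at p)" and "\<kappa> differentiable (at p)"
    and \<zeta>1: "partial1 \<zeta> p = 1 / 2 * (a\<^sup>2 + r\<^sup>2 * b\<^sup>2 / \<eta>\<^sup>2)" and \<zeta>2: "partial2 \<zeta> p = a * b"
    and \<kappa>2: "partial2 \<kappa> p = \<eta> * partial1 \<zeta> p" and \<kappa>1: "partial1 \<kappa> p = r\<^sup>2 / \<eta> * partial2 \<zeta> p"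
  shows "slope_deriv (s * (r / \<eta>)) (\<lambda>q. f (\<zeta> q, \<kappa> q)) p =
           (a + s * (r * b / \<eta>))\<^sup>2 / 2 * slope_deriv (s * r) f (\<zeta> p, \<kappa> p)"
proof -
  let ?c = "r * b / \<eta>"
  let ?f1 = "partial1 f (\<zeta> p, \<kappa> p)" and ?f2 = "partial2 f (\<zeta> p, \<kappa> p)"
  have sq: "(a + s * ?c)\<^sup>2 / 2 = partial1 \<zeta> p + s * (r / \<eta>) * partial2 \<zeta> p"
    using s by (simp add: \<zeta>1 \<zeta>2 power2_sum power_mult_distrib power_divide algebra_simps)
  have "slope_deriv (s * (r / \<eta>)) (\<lambda>q. f (\<zeta> q, \<kappa> q)) p =
      ?f1 * (partial1 \<zeta> p + s * (r / \<eta>) * partial2 \<zeta> p)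
      + ?f2 * (r\<^sup>2 / \<eta> * partial2 \<zeta> p + s * (r / \<eta>) * (\<eta> * partial1 \<zeta> p))"
    using assms(3-5) by (simp add: slope_deriv_def partials_compose \<kappa>1 \<kappa>2 algebra_simps)
  also have "r\<^sup>2 / \<eta> * partial2 \<zeta> p + s * (r / \<eta>) * (\<eta> * partial1 \<zeta> p) =
      s * r * (partial1 \<zeta> p) + s\<^sup>2 * r\<^sup>2 / \<eta> * partial2 \<zeta> p"
    using assms(1) s by simp
  also have "\<dots> = s * r * (partial1 \<zeta> p + s * (r / \<eta>) * partial2 \<zeta> p)"
    by (simp add: power2_eq_square algebra_simps)
  finally show ?thesis
    unfolding sq by (simp add: slope_deriv_def algebra_simps)
qed

section \<open>Transformation of the wave equation\<close>

theorem theorem2: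
  fixes \<eta> :: real
    and U V :: "(real \<times> real) set"
    and R \<zeta> \<kappa> \<rho> :: "real \<times> real \<Rightarrow> real"
  assumes "\<eta> \<noteq> 0"
    and "open U"
    and "smooth_on U R" and "smooth_on U \<zeta>" and "smooth_on U \<kappa>"
    and "\<And>p. p \<in> U \<Longrightarrow>
           \<eta>\<^sup>2 * partial1 (partial1 R) p = R p * partial2 (\<lambda>q. R q * partial2 R q) p"
    and "\<And>p. p \<in> U \<Longrightarrow>
           partial1 \<zeta> p = 1 / 2 * ((partial1 R p)\<^sup>2 + (R p)\<^sup>2 * (partial2 R p)\<^sup>2 / \<eta>\<^sup>2)"
    and "\<And>p. p \<in> U \<Longrightarrow> partial2 \<zeta> p = partial1 R p * partial2 R p"
    and "\<And>p. p \<in> U \<Longrightarrow> partial2 \<kappa> p = \<eta> * partial1 \<zeta> p"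
    and "\<And>p. p \<in> U \<Longrightarrow> partial1 \<kappa> p = (R p)\<^sup>2 / \<eta> * partial2 \<zeta> p"
    and "diffeomorphism_on U V (\<lambda>p. (\<zeta> p, \<kappa> p))"
    and "\<And>p. p \<in> U \<Longrightarrow> \<rho> (\<zeta> p, \<kappa> p) = R p"
  shows "smooth_on V \<rho> \<and>
         (\<forall>v\<in>V. partial1 (partial1 \<rho>) v = \<rho> v * partial2 (\<lambda>w. \<rho> w * partial2 \<rho> w) v)"
proof -
  define \<Phi> where "\<Phi> = (\<lambda>p. (\<zeta> p, \<kappa> p))"
  define x where "x = (\<lambda>v. fst (inv_into U \<Phi> v))"
  define y where "y = (\<lambda>v. snd (inv_into U \<Phi> v))"
  have V: "open V" and bij: "bij_betw \<Phi> U V" and x: "smooth_on V x" and y: "smooth_on V y"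
    using assms(11) by (auto simp: diffeomorphism_on_def smooth_map_on_def \<Phi>_def x_def y_def)
  have xy_in: "(x v, y v) \<in> U" and \<Phi>_xy: "\<Phi> (x v, y v) = v" if "v \<in> V" for v
    using that bij by (auto simp: x_def y_def bij_betw_def inv_into_into f_inv_into_f)
  have x_\<Phi>: "x (\<zeta> p, \<kappa> p) = fst p" if "p \<in> U" for p
    using bij_betw_inv_into_left[OF bij that] by (simp add: x_def \<Phi>_def)
  have \<Phi>_in: "(\<zeta> p, \<kappa> p) \<in> V" if "p \<in> U" for p
    using that bij by (auto simp: \<Phi>_def bij_betw_def)

  have "smooth_on V (\<lambda>v. R (x v, y v))"
    using assms(2,3) V x y xy_in by (auto simp: smooth_on_def intro: Ck_on_compose)
  moreover have "R (x v, y v) = \<rho> v" if "v \<in> V" for v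
    using assms(12)[OF xy_in[OF that]] \<Phi>_xy[OF that] by (simp add: \<Phi>_def)
  ultimately have \<rho>: "smooth_on V \<rho>"
    unfolding smooth_on_def using Ck_on_cong[OF V] by blast

  define a where "a = partial1 R"
  define c where "c = (\<lambda>p. R p * partial2 R p / \<eta>)"
  define P where "P = partial1 \<rho>"
  define Q where "Q = (\<lambda>w. \<rho> w * partial2 \<rho> w)"
  have P: "smooth_on V P" and Q: "smooth_on V Q"
    unfolding P_def Q_def using \<rho> V by (auto intro: smooth_on_partials smooth_on_mult)
  have a: "smooth_on U a" and Rb: "smooth_on U (\<lambda>p. R p * partial2 R p)"
    unfolding a_def using assms(2,3) by (auto intro: smooth_on_partials smooth_on_mult)
  have c_eq: "c = (\<lambda>p. (1 / \<eta>) * (R p * partial2 R p))"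
    by (simp add: c_def)
  note dU = smooth_on_imp_differentiable[OF _ assms(2)]
  note dV = smooth_on_imp_differentiable[OF _ V \<Phi>_in]
  have dc: "c differentiable (at p)" if "p \<in> U" for p
    unfolding c_eq by (rule differentiable_mult[OF differentiable_const dU[OF Rb that]])

  have transport: "slope_deriv (s * (R p / \<eta>)) (\<lambda>q. f (\<zeta> q, \<kappa> q)) p =
      (a p + s * c p)\<^sup>2 / 2 * slope_deriv (s * R p) f (\<zeta> p, \<kappa> p)"
    if "p \<in> U" and "s\<^sup>2 = 1" and "f differentiable (at (\<zeta> p, \<kappa> p))" for p s f
    unfolding c_def a_def
    using that assms(1) dU[OF assms(4)] dU[OF assms(5)] assms(7-10)
    by (intro characteristic_transport) auto

  \<comment> \<open>The coordinate \<open>\<tau>\<close> is itself of the form \<open>f \<circ> \<Phi>\<close>, and its derivative along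
    \<open>\<partial>\<^sub>\<tau> \<plusminus> (R / \<eta>) \<partial>\<^sub>\<mu>\<close> is 1. This replaces a computation of the Jacobian, which is
    \<open>(\<eta> / 4) (a + c)\<^sup>2 (a - c)\<^sup>2\<close>.\<close>
  have nz: "a p + s * c p \<noteq> 0" if p: "p \<in> U" and s: "s\<^sup>2 = 1" for p s
  proof
    assume "a p + s * c p = 0"
    then have 0: "slope_deriv (s * (R p / \<eta>)) (\<lambda>q. x (\<zeta> q, \<kappa> q)) p = 0"
      using transport[OF p s dV[OF x p]] by simp
    have "(fst has_derivative fst) (at p)"
      by (rule bounded_linear_imp_has_derivative[OF bounded_linear_fst])
    from has_derivative_imp_partials[OF this]
    have "slope_deriv l fst p = 1" for l by (simp add: slope_deriv_def)
    moreover have "slope_deriv l fst p = slope_deriv l (\<lambda>q. x (\<zeta> q, \<kappa> q)) p" for l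
      unfolding slope_deriv_def
      using partials_transform[of "\<lambda>q. x (\<zeta> q, \<kappa> q)" p U fst] x_\<Phi> p assms(2)
        differentiable_compose_Pair[OF dV[OF x p] dU[OF assms(4) p] dU[OF assms(5) p]]
      by simp
    ultimately show False using 0 by simp
  qed

  \<comment> \<open>Transport of \<open>\<rho>\<close>, divided by \<open>a \<plusminus> c\<close>. The identity is kept as a product so that it can be
    differentiated with the Leibniz rule.\<close>
  have PQ: "(P (\<zeta> p, \<kappa> p) + s * Q (\<zeta> p, \<kappa> p)) * (a p + s * c p) = 2"
    if p: "p \<in> U" and s: "s\<^sup>2 = 1" for p s
  proof -
    have "slope_deriv l (\<lambda>q. \<rho> (\<zeta> q, \<kappa> q)) p = slope_deriv l R p" for l
      unfolding slope_deriv_def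
      using partials_transform[of R p U "\<lambda>q. \<rho> (\<zeta> q, \<kappa> q)"] assms(12) p assms(2) dU[OF assms(3) p]
      by simp
    with transport[OF p s dV[OF \<rho> p]]
    have "slope_deriv (s * (R p / \<eta>)) R p =
        (a p + s * c p)\<^sup>2 / 2 * slope_deriv (s * R p) \<rho> (\<zeta> p, \<kappa> p)"
      by simp
    then have "a p + s * c p = (a p + s * c p)\<^sup>2 / 2 * (P (\<zeta> p, \<kappa> p) + s * Q (\<zeta> p, \<kappa> p))"
      using assms(12)[OF p] by (simp add: slope_deriv_def a_def c_def P_def Q_def algebra_simps)
    moreover have "w * d = 2" if "d = d\<^sup>2 / 2 * w" and "d \<noteq> 0" for d w :: real
      using that by (simp add: power2_eq_square mult.commute)
    ultimately show ?thesis using nz[OF p s] by blast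
  qed

  \<comment> \<open>\<open>P + s Q\<close> is differentiated along the family with the opposite sign: the transport
    factor is then \<open>(a - s c)\<^sup>2 / 2\<close>, and together with the factor \<open>(a + s c)\<^sup>2\<close> from the
    reciprocal it gives a product that does not depend on the sign \<open>s\<close>.\<close>
  have cross: "(a p + s * c p)\<^sup>2 * (a p - s * c p)\<^sup>2 *
      (slope_deriv (- s * R p) P (\<zeta> p, \<kappa> p) + s * slope_deriv (- s * R p) Q (\<zeta> p, \<kappa> p))
      = - 4 * (slope_deriv (- s * (R p / \<eta>)) a p + s * slope_deriv (- s * (R p / \<eta>)) c p)"
    if p: "p \<in> U" and s: "s\<^sup>2 = 1" for p s
  proof -
    let ?f = "\<lambda>v. P v + s * Q v" and ?g = "\<lambda>q. a q + s * c q"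
    let ?l = "- s * (R p / \<eta>)"
    have df: "?f differentiable (at (\<zeta> p, \<kappa> p))"
      using dV[OF P p] dV[OF Q p] by (intro differentiable_add differentiable_mult) auto
    have dg: "?g differentiable (at p)"
      using dU[OF a p] dc[OF p] by (intro differentiable_add differentiable_mult) auto
    have df\<Phi>: "(\<lambda>q. ?f (\<zeta> q, \<kappa> q)) differentiable (at p)"
      using differentiable_compose_Pair[OF df dU[OF assms(4) p] dU[OF assms(5) p]] .
    have "slope_deriv ?l (\<lambda>q. ?f (\<zeta> q, \<kappa> q)) p * ?g p + ?f (\<zeta> p, \<kappa> p) * slope_deriv ?l ?g p = 0"
      using slope_deriv_mult_constant[OF df\<Phi> dg assms(2) p] PQ s by blast
    moreover have "slope_deriv ?l (\<lambda>q. ?f (\<zeta> q, \<kappa> q)) p =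
        (a p - s * c p)\<^sup>2 / 2 * slope_deriv (- s * R p) ?f (\<zeta> p, \<kappa> p)"
      using transport[OF p _ df, of "- s"] s by simp
    moreover have "g\<^sup>2 * e\<^sup>2 * Y = - 4 * G" if "X * g + f * G = 0" and "X = e\<^sup>2 / 2 * Y" and "f * g = 2"
      for X Y G e f g :: real
    proof -
      have "g\<^sup>2 * X + (f * g) * G = g * (X * g + f * G)"
        by (simp add: power2_eq_square algebra_simps)
      then show ?thesis using that by simp
    qed
    ultimately have "(?g p)\<^sup>2 * (a p - s * c p)\<^sup>2 * slope_deriv (- s * R p) ?f (\<zeta> p, \<kappa> p)
        = - 4 * slope_deriv ?l ?g p"
      using PQ[OF p s] by blast
    then show ?thesis
      using slope_deriv_add_cmult[OF dV[OF P p] dV[OF Q p]] slope_deriv_add_cmult[OF dU[OF a p] dc[OF p]]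
      by simp
  qed

  have "partial1 P (\<zeta> p, \<kappa> p) = R p * partial2 Q (\<zeta> p, \<kappa> p)" if p: "p \<in> U" for p
  proof -
    have "partial2 c p = (1 / \<eta>) * partial2 (\<lambda>q. R q * partial2 R q) p"
      unfolding c_eq using partials_cmult(2)[OF dU[OF Rb p]] .
    then have "\<eta>\<^sup>2 * partial1 a p = \<eta> * R p * partial2 c p"
      using assms(6)[OF p] assms(1) by (simp add: a_def)
    then have wave: "partial1 a p = R p / \<eta> * partial2 c p"
      using assms(1) by (simp add: power2_eq_square field_simps)
    \<comment> \<open>The sum of the two instances of \<open>cross\<close>: the terms \<open>R \<partial>\<^sub>\<kappa> P\<close> and \<open>\<partial>\<^sub>\<zeta> Q\<close> on the left,
      and \<open>(R / \<eta>) \<partial>\<^sub>\<mu> a\<close> and \<open>\<partial>\<^sub>\<tau> c\<close> on the right, occur with both signs.\<close>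
    let ?X = "\<lambda>s f. slope_deriv (- s * R p) f (\<zeta> p, \<kappa> p)"
    let ?L = "\<lambda>s f. slope_deriv (- s * (R p / \<eta>)) f p"
    let ?K = "(a p + c p)\<^sup>2 * (a p - c p)\<^sup>2"
    have "?K * ((?X 1 P + ?X 1 Q) + (?X (- 1) P - ?X (- 1) Q))
        = - 4 * ((?L 1 a + ?L 1 c) + (?L (- 1) a - ?L (- 1) c))"
      using cross[OF p, of 1] cross[OF p, of "- 1"] by (simp add: distrib_left mult.commute)
    moreover have "(?X 1 P + ?X 1 Q) + (?X (- 1) P - ?X (- 1) Q)
        = 2 * (partial1 P (\<zeta> p, \<kappa> p) - R p * partial2 Q (\<zeta> p, \<kappa> p))"
      by (simp add: slope_deriv_def algebra_simps)
    moreover have "(?L 1 a + ?L 1 c) + (?L (- 1) a - ?L (- 1) c) = 2 * (partial1 a p - R p / \<eta> * partial2 c p)"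
      by (simp add: slope_deriv_def algebra_simps)
    ultimately have "?K * (2 * (partial1 P (\<zeta> p, \<kappa> p) - R p * partial2 Q (\<zeta> p, \<kappa> p))) = 0"
      using wave by simp
    then show ?thesis
      using nz[OF p, of 1] nz[OF p, of "- 1"] by simp
  qed
  then have "partial1 P v = \<rho> v * partial2 Q v" if "v \<in> V" for v
    using assms(12)[OF xy_in[OF that]] xy_in[OF that] \<Phi>_xy[OF that] by (metis \<Phi>_def)
  with \<rho> show ?thesis by (simp add: P_def Q_def)
qed

end
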